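(* Let $\mathcal{P}$ and $\mathcal{Q}$ be posets on disjoint finite sets $S$ and $T$, respectively. If $\eta\in\mathrm{NN}(\mathcal{P},q)$ and $\nu\in\mathrm{NN}(\mathcal{Q},q)$, then $$\mu_{\mathcal{P},\mathcal{Q}}(\chi_\eta\otimes\chi_\nu)=\chi_{\eta\sqcup\nu}.$$
   Context: $\mathbb{F}_q$ is the field with $q$ elements and $\theta:\mathbb{F}_q^+\to\mathbb{C}^\times$ is a fixed nontrivial homomorphism. For a poset $\mathcal{P}$ on a finite set $I$, $\mathfrak{u}_\mathcal{P}$ is the algebra of matrices $x=(x_{ij})_{i,j\in I}$ over $\mathbb{F}_q$ with $x_{ij}=0$ unless $i\prec_\mathcal{P}j$, and $U_\mathcal{P}=\{1+x\mid x\in\mathfrak{u}_\mathcal{P}\}$ (the pattern group) with matrix multiplication; $f:U_\mathcal{P}\to\mathfrak{u}_\mathcal{P}$ is $f(1+x)=x$; $e_{ij}$ is the elementary matrix. An $(\mathbb{F}_q,\mathcal{P})$-set partition is a set $\eta$ of labeled arcs $i\overset{a}{\frown}j$ ($i,j\in I$, $a\in\mathbb{F}_q^\times$, at most one label for each pair) such that (1) $i\prec_\mathcal{P}j$ for every arc; (2) if $i\overset{a}{\frown}j\in\eta$ and $i\prec_\mathcal{P}k\prec_\mathcal{P}j$, then $\eta$ has no arc from $i$ to $k$ and none from $k$ to $j$ (with any label). It is nonnesting if there are no arcs $i\overset{a}{\frown}j,k\overset{b}{\frown}l\in\eta$ with $i\prec_\mathcal{P}k\prec_\mathcal{P}l\prec_\mathcal{P}j$.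 $\mathrm{NN}(\mathcal{P},q)$ is the set of nonnesting $(\mathbb{F}_q,\mathcal{P})$-set partitions. For $\lambda\in\mathfrak{u}_\mathcal{P}^*$ (the dual space), $\mathrm{big}(\lambda)\in\mathrm{NN}(\mathcal{P},q)$ is the set of arcs $i\overset{\lambda(e_{ij})}{\frown}j$ with $i\prec_\mathcal{P}j$, $\lambda(e_{ij})\neq0$, and $\lambda(e_{kl})=0$ whenever $(k,l)\neq(i,j)$ and $k\preceq_\mathcal{P}i\prec_\mathcal{P}j\preceq_\mathcal{P}l$. For $\eta\in\mathrm{NN}(\mathcal{P},q)$, $\chi_\eta=\sum_{\lambda\in\mathfrak{u}_\mathcal{P}^*,\ \mathrm{big}(\lambda)=\eta}\theta\circ\lambda\circ f$, a function on $U_\mathcal{P}$. For posets $\mathcal{P}$ on $S$ and $\mathcal{Q}$ on $T$ ($S,T$ disjoint), $\mathcal{P}\cdot\mathcal{Q}$ is the poset on $S\sqcup T$ with $x\prec y$ iff $x,y\in S$ and $x\prec_\mathcal{P}y$, or $x,y\in T$ and $x\prec_\mathcal{Q}y$, or $x\in S$ and $y\in T$. For $\eta\in\mathrm{NN}(\mathcal{P},q)$, $\nu\in\mathrm{NN}(\mathcal{Q},q)$, $\eta\sqcup\nu$ is the union of the two arc sets; it is a nonnesting $(\mathbb{F}_q,\mathcal{P}\cdot\mathcal{Q})$-set partition. For functions $\alpha:U_\mathcal{P}\to\mathbb{C}$ and $\beta:U_\mathcal{Q}\to\mathbb{C}$, $\mu_{\mathcal{P},\mathcal{Q}}(\alpha\otimes\beta)$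 is the function on $U_{\mathcal{P}\cdot\mathcal{Q}}$ given by $g\mapsto\alpha(g_S)\beta(g_T)$, where $g_S,g_T$ are the submatrices of $g$ indexed by $S$ and by $T$. *)

theory Defs
  imports Complex_Main "HOL-Library.FuncSet"
begin

text \<open>
  A poset on \<open>I\<close> is a reflexive relation \<open>P\<close> with \<^term>\<open>partial_order_on I P\<close>, so that
  \<open>i \<preceq> j\<close> is \<^term>\<open>(i, j) \<in> P\<close>. The field with \<open>q\<close> elements is a type of class \<open>{field, finite}\<close>.
  A matrix with index set \<open>I\<close> is a function of two arguments that vanishes outside \<open>I \<times> I\<close>.
  A function on a set is an extensional function, with value \<^const>\<open>undefined\<close> outside the set:
  equality of such functions is then plain equality, and summing over a set of them counts each
  one once.
\<close>

type_synonym ('a, 'q) mat = "'a \<Rightarrow> 'a \<Rightarrow> 'q"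

definition prec :: "'a rel \<Rightarrow> 'a \<Rightarrow> 'a \<Rightarrow> bool"
  where "prec P i j \<longleftrightarrow> (i, j) \<in> P \<and> i \<noteq> j"

definition mat_add :: "('a, 'q::field) mat \<Rightarrow> ('a, 'q) mat \<Rightarrow> ('a, 'q) mat"
  where "mat_add x y = (\<lambda>i j. x i j + y i j)"

definition mat_smult :: "'q::field \<Rightarrow> ('a, 'q) mat \<Rightarrow> ('a, 'q) mat"
  where "mat_smult c x = (\<lambda>i j. c * x i j)"

definition mat_one :: "'a set \<Rightarrow> ('a, 'q::field) mat"
  where "mat_one I = (\<lambda>i j. if i = j \<and> i \<in> I then 1 else 0)"

definition elem_mat :: "'a \<Rightarrow> 'a \<Rightarrow> ('a, 'q::field) mat"
  where "elem_mat i j = (\<lambda>k l. if k = i \<and> l = j then 1 else 0)"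

definition submat :: "'a set \<Rightarrow> ('a, 'q::field) mat \<Rightarrow> ('a, 'q) mat"
  where "submat S g = (\<lambda>i j. if i \<in> S \<and> j \<in> S then g i j else 0)"

definition pattern_alg :: "'a rel \<Rightarrow> ('a, 'q::field) mat set"
  where "pattern_alg P = {x. \<forall>i j. \<not> prec P i j \<longrightarrow> x i j = 0}"

text \<open>
  Only the underlying set of the pattern group matters below; its multiplication is not used.
\<close>

definition pattern_group :: "'a set \<Rightarrow> 'a rel \<Rightarrow> ('a, 'q::field) mat set"
  where "pattern_group I P = {mat_add (mat_one I) x | x. x \<in> pattern_alg P}"

definition group_to_alg :: "'a set \<Rightarrow> ('a, 'q::field) mat \<Rightarrow> ('a, 'q) mat"
  where "group_to_alg I g = (\<lambda>i j. g i j - mat_one I i j)"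

definition pattern_dual :: "'a rel \<Rightarrow> (('a, 'q::field) mat \<Rightarrow> 'q) set"
  where "pattern_dual P = {lam \<in> extensional (pattern_alg P).
    (\<forall>x \<in> pattern_alg P. \<forall>y \<in> pattern_alg P. lam (mat_add x y) = lam x + lam y) \<and>
    (\<forall>c. \<forall>x \<in> pattern_alg P. lam (mat_smult c x) = c * lam x)}"

text \<open>
  The arc from \<open>i\<close> to \<open>j\<close> with label \<open>a\<close> is the triple \<open>(i, a, j)\<close>.
\<close>

definition set_partition :: "'a rel \<Rightarrow> ('a \<times> 'q::field \<times> 'a) set \<Rightarrow> bool"
  where "set_partition P eta \<longleftrightarrow>
    (\<forall>i a j. (i, a, j) \<in> eta \<longrightarrow> a \<noteq> 0 \<and> prec P i j) \<and>
    (\<forall>i a b j. (i, a, j) \<in> eta \<longrightarrow> (i, b, j) \<in> eta \<longrightarrow> a = b) \<and>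
    (\<forall>i a j k. (i, a, j) \<in> eta \<longrightarrow> prec P i k \<longrightarrow> prec P k j \<longrightarrow>
       (\<forall>b. (i, b, k) \<notin> eta \<and> (k, b, j) \<notin> eta))"

definition NN :: "'a rel \<Rightarrow> ('a \<times> 'q::field \<times> 'a) set set"
  where "NN P = {eta. set_partition P eta \<and>
    \<not> (\<exists>i a j k b l. (i, a, j) \<in> eta \<and> (k, b, l) \<in> eta \<and>
         prec P i k \<and> prec P k l \<and> prec P l j)}"

definition big :: "'a rel \<Rightarrow> (('a, 'q::field) mat \<Rightarrow> 'q) \<Rightarrow> ('a \<times> 'q \<times> 'a) set"
  where "big P lam = {(i, lam (elem_mat i j), j) | i j.
    prec P i j \<and> lam (elem_mat i j) \<noteq> 0 \<and>
    (\<forall>k l. (k, l) \<noteq> (i, j) \<longrightarrow> (k, i) \<in> P \<longrightarrow> (j, l) \<in> P \<longrightarrow> lam (elem_mat k l) = 0)}"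

definition chi :: "('q \<Rightarrow> complex) \<Rightarrow> 'a set \<Rightarrow> 'a rel \<Rightarrow> ('a \<times> 'q::field \<times> 'a) set \<Rightarrow>
    ('a, 'q) mat \<Rightarrow> complex"
  where "chi theta I P eta = (\<lambda>g \<in> pattern_group I P.
    \<Sum>lam | lam \<in> pattern_dual P \<and> big P lam = eta. theta (lam (group_to_alg I g)))"

definition poset_concat :: "'a set \<Rightarrow> 'a rel \<Rightarrow> 'a set \<Rightarrow> 'a rel \<Rightarrow> 'a rel"
  where "poset_concat S P T Q = P \<union> Q \<union> S \<times> T"

text \<open>
  \<open>mu S P T Q \<alpha> \<beta>\<close> is the value of the product map at the pure tensor \<open>\<alpha> \<otimes> \<beta>\<close>.
\<close>

definition mu :: "'a set \<Rightarrow> 'a rel \<Rightarrow> 'a set \<Rightarrow> 'a rel \<Rightarrow>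
    (('a, 'q::field) mat \<Rightarrow> complex) \<Rightarrow> (('a, 'q) mat \<Rightarrow> complex) \<Rightarrow> ('a, 'q) mat \<Rightarrow> complex"
  where "mu S P T Q alpha beta = (\<lambda>g \<in> pattern_group (S \<union> T) (poset_concat S P T Q).
    alpha (submat S g) * beta (submat T g))"

text \<open>
  The following facts show that the objects above are well defined: the sum in \<^const>\<open>chi\<close> is
  finite, the concatenation is a poset with the intended strict order, submatrices land
  in the pattern groups of the factors, and \<^const>\<open>big\<close> and unions of arc sets yield nonnesting
  set partitions.
\<close>

lemma finite_pattern_dual:
  assumes "finite I" "partial_order_on I P"
  shows "finite (pattern_dual P :: (('a, 'q::{field,finite}) mat \<Rightarrow> 'q) set)"
proof -
  have PI: "P \<subseteq> I \<times> I"
    using assms(2) by (rule partial_order_onD)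
  let ?F = "\<lambda>h :: 'a \<times> 'a \<Rightarrow> 'q. \<lambda>i j. if (i, j) \<in> I \<times> I then h (i, j) else 0"
  have "(pattern_alg P :: ('a, 'q) mat set) \<subseteq> ?F ` (I \<times> I \<rightarrow>\<^sub>E UNIV)"
  proof
    fix x :: "('a, 'q) mat" assume x: "x \<in> pattern_alg P"
    have z: "x i j = 0" if "(i, j) \<notin> I \<times> I" for i j
    proof -
      have "\<not> prec P i j" using that PI unfolding prec_def by blast
      then show ?thesis using x by (simp add: pattern_alg_def)
    qed
    have "x i j = ?F (restrict (\<lambda>(i, j). x i j) (I \<times> I)) i j" for i j
      using z[of i j] by (cases "(i, j) \<in> I \<times> I") simp_all
    then have "x = ?F (restrict (\<lambda>(i, j). x i j) (I \<times> I))"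
      by (intro ext)
    then show "x \<in> ?F ` (I \<times> I \<rightarrow>\<^sub>E UNIV)"
      by (rule image_eqI[where x = "restrict (\<lambda>(i, j). x i j) (I \<times> I)"]) simp
  qed
  moreover have "finite (?F ` (I \<times> I \<rightarrow>\<^sub>E UNIV))"
    using assms(1) by (intro finite_imageI finite_PiE) auto
  ultimately have "finite (pattern_alg P :: ('a, 'q) mat set)"
    by (rule finite_subset)
  then have "finite ((pattern_alg P :: ('a, 'q) mat set) \<rightarrow>\<^sub>E (UNIV :: 'q set))"
    by (intro finite_PiE) auto
  moreover have "pattern_dual P \<subseteq> (pattern_alg P :: ('a, 'q) mat set) \<rightarrow>\<^sub>E (UNIV :: 'q set)"
    by (auto simp: pattern_dual_def PiE_def)
  ultimately show ?thesis by (rule rev_finite_subset)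
qed

lemma prec_poset_concat:
  assumes "S \<inter> T = {}"
  shows "prec (poset_concat S P T Q) x y \<longleftrightarrow> prec P x y \<or> prec Q x y \<or> (x \<in> S \<and> y \<in> T)"
  using assms by (auto simp: prec_def poset_concat_def)

lemma partial_order_on_poset_concat:
  assumes P: "partial_order_on S P" and Q: "partial_order_on T Q" and ST: "S \<inter> T = {}"
  shows "partial_order_on (S \<union> T) (poset_concat S P T Q)"
proof -
  note p = partial_order_onD[OF P] and q = partial_order_onD[OF Q]
  have "refl_on (S \<union> T) (poset_concat S P T Q)"
    using p(1) q(1) by (auto simp: refl_on_def poset_concat_def)
  moreover have "trans (poset_concat S P T Q)"
  proof (rule transI)
    fix x y z
    assume "(x, y) \<in> poset_concat S P T Q" "(y, z) \<in> poset_concat S P T Q"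
    then show "(x, z) \<in> poset_concat S P T Q"
      using p(4) q(4) ST transD[OF p(2), of x y z] transD[OF q(2), of x y z]
      unfolding poset_concat_def by blast
  qed
  moreover have "antisym (poset_concat S P T Q)"
  proof (rule antisymI)
    fix x y
    assume "(x, y) \<in> poset_concat S P T Q" "(y, x) \<in> poset_concat S P T Q"
    then show "x = y"
      using p(4) q(4) ST antisymD[OF p(3), of x y] antisymD[OF q(3), of x y]
      unfolding poset_concat_def by blast
  qed
  moreover have "poset_concat S P T Q \<subseteq> (S \<union> T) \<times> (S \<union> T)"
    using p(4) q(4) unfolding poset_concat_def by blast
  ultimately show ?thesis
    by (simp add: partial_order_on_def preorder_on_def)
qed

lemma submat_pattern_group:
  assumes P: "partial_order_on S P" and Q: "partial_order_on T Q" and ST: "S \<inter> T = {}"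
    and g: "g \<in> pattern_group (S \<union> T) (poset_concat S P T Q)"
  shows "submat S g \<in> pattern_group S P" and "submat T g \<in> pattern_group T Q"
proof -
  note p = partial_order_onD(4)[OF P] and q = partial_order_onD(4)[OF Q]
  obtain x where x: "x \<in> pattern_alg (poset_concat S P T Q)"
    and gx: "g = mat_add (mat_one (S \<union> T)) x"
    using g by (auto simp: pattern_group_def)
  have z: "x i j = 0" if "\<not> prec (poset_concat S P T Q) i j" for i j
    using x that by (simp add: pattern_alg_def)
  have "submat S x i j = 0" if "\<not> prec P i j" for i j
  proof (cases "i \<in> S \<and> j \<in> S")
    case True
    then have "\<not> prec (poset_concat S P T Q) i j"
      using that q ST unfolding prec_poset_concat[OF ST] by (auto simp: prec_def)
    then show ?thesis using z by (simp add: submat_def)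
  next
    case False
    then show ?thesis by (auto simp: submat_def)
  qed
  moreover have "submat T x i j = 0" if "\<not> prec Q i j" for i j
  proof (cases "i \<in> T \<and> j \<in> T")
    case True
    then have "\<not> prec (poset_concat S P T Q) i j"
      using that p ST unfolding prec_poset_concat[OF ST] by (auto simp: prec_def)
    then show ?thesis using z by (simp add: submat_def)
  next
    case False
    then show ?thesis by (auto simp: submat_def)
  qed
  ultimately have "submat S x \<in> pattern_alg P" "submat T x \<in> pattern_alg Q"
    by (simp_all add: pattern_alg_def)
  moreover have "submat S g = mat_add (mat_one S) (submat S x)"
    "submat T g = mat_add (mat_one T) (submat T x)"
    unfolding gx by (simp_all add: submat_def mat_add_def mat_one_def fun_eq_iff)
  ultimately show "submat S g \<in> pattern_group S P" "submat T g \<in> pattern_group T Q"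
    by (auto simp: pattern_group_def)
qed

lemma big_in_NN:
  assumes "partial_order_on I P"
  shows "big P lam \<in> NN P"
proof -
  note p = partial_order_onD[OF assms]
  have r: "(x, x) \<in> P" if "x \<in> I" for x using p(1) that by (auto simp: refl_on_def)
  have max: "prec P i j \<and> a = lam (elem_mat i j) \<and> a \<noteq> 0 \<and>
      (\<forall>k l. (k, l) \<noteq> (i, j) \<longrightarrow> (k, i) \<in> P \<longrightarrow> (j, l) \<in> P \<longrightarrow> lam (elem_mat k l) = 0)"
    if "(i, a, j) \<in> big P lam" for i a j
    using that unfolding big_def mem_Collect_eq by (elim exE conjE) simp
  have no_nest: "(k, b, l) \<notin> big P lam"
    if "(i, a, j) \<in> big P lam" "(i, k) \<in> P" "(l, j) \<in> P" "(i, j) \<noteq> (k, l)" for i a j k b l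
    using max[OF that(1)] max[of k b l] that(2-4) by metis
  have sub: "(x, x) \<in> P \<and> (y, y) \<in> P" if "prec P x y" for x y
    using that r p(4) by (auto simp: prec_def)
  have "set_partition P (big P lam)"
    unfolding set_partition_def
  proof (intro conjI allI impI)
    fix i a j assume "(i, a, j) \<in> big P lam"
    then show "a \<noteq> 0" "prec P i j" using max by blast+
  next
    fix i a b j assume "(i, a, j) \<in> big P lam" "(i, b, j) \<in> big P lam"
    then show "a = b" using max by metis
  next
    fix i a j k b
    assume ij: "(i, a, j) \<in> big P lam" and k: "prec P i k" "prec P k j"
    show "(i, b, k) \<notin> big P lam"
      using no_nest[OF ij, of i k b] sub[OF k(1)] k by (auto simp: prec_def)
    show "(k, b, j) \<notin> big P lam"
      using no_nest[OF ij, of k j b] sub[OF k(2)] k by (auto simp: prec_def)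
  qed
  moreover have "\<not> (\<exists>i a j k b l. (i, a, j) \<in> big P lam \<and> (k, b, l) \<in> big P lam \<and>
         prec P i k \<and> prec P k l \<and> prec P l j)"
    using no_nest unfolding prec_def by blast
  ultimately show ?thesis unfolding NN_def by blast
qed

lemma union_in_NN:
  assumes P: "partial_order_on S P" and Q: "partial_order_on T Q" and ST: "S \<inter> T = {}"
    and eta: "eta \<in> NN P" and nu: "nu \<in> NN Q"
  shows "eta \<union> nu \<in> NN (poset_concat S P T Q)"
proof -
  note p = partial_order_onD(4)[OF P] and q = partial_order_onD(4)[OF Q]
  have pS: "x \<in> S \<and> y \<in> S" if "prec P x y" for x y using that p by (auto simp: prec_def)
  have qT: "x \<in> T \<and> y \<in> T" if "prec Q x y" for x y using that q by (auto simp: prec_def)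
  have e1: "a \<noteq> 0 \<and> prec P i j" if "(i, a, j) \<in> eta" for i a j
    using eta that unfolding NN_def set_partition_def by blast
  have n1: "a \<noteq> 0 \<and> prec Q i j" if "(i, a, j) \<in> nu" for i a j
    using nu that unfolding NN_def set_partition_def by blast
  have e1': "i \<in> S \<and> j \<in> S" if "(i, a, j) \<in> eta" for i a j using e1[OF that] pS by blast
  have n1': "i \<in> T \<and> j \<in> T" if "(i, a, j) \<in> nu" for i a j using n1[OF that] qT by blast
  note c = prec_poset_concat[OF ST]
  have dis: "x \<in> S \<Longrightarrow> x \<in> T \<Longrightarrow> False" for x using ST by blast
  have cS: "prec P x y" if "prec (poset_concat S P T Q) x y" "y \<in> S" for x y
    using that qT[of x y] dis[of y] c[of P Q x y] by auto
  have cT: "prec Q x y" if "prec (poset_concat S P T Q) x y" "x \<in> T" for x y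
    using that pS[of x y] dis[of x] c[of P Q x y] by auto
  have e2: "a = b" if "(i, a, j) \<in> eta" "(i, b, j) \<in> eta" for i a b j
    using eta that unfolding NN_def set_partition_def by blast
  have n2: "a = b" if "(i, a, j) \<in> nu" "(i, b, j) \<in> nu" for i a b j
    using nu that unfolding NN_def set_partition_def by blast
  have e3: "(i, b, k) \<notin> eta \<and> (k, b, j) \<notin> eta"
    if "(i, a, j) \<in> eta" "prec P i k" "prec P k j" for i a j k b
    using eta that unfolding NN_def set_partition_def by blast
  have n3: "(i, b, k) \<notin> nu \<and> (k, b, j) \<notin> nu"
    if "(i, a, j) \<in> nu" "prec Q i k" "prec Q k j" for i a j k b
    using nu that unfolding NN_def set_partition_def by blast
  have e4: False if "(i, a, j) \<in> eta" "(k, b, l) \<in> eta" "prec P i k" "prec P l j" for i a j k b l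
    using eta that e1[OF that(2)] unfolding NN_def by blast
  have n4: False if "(i, a, j) \<in> nu" "(k, b, l) \<in> nu" "prec Q i k" "prec Q l j" for i a j k b l
    using nu that n1[OF that(2)] unfolding NN_def by blast
  have "set_partition (poset_concat S P T Q) (eta \<union> nu)"
    unfolding set_partition_def
  proof (intro conjI allI impI)
    fix i a j assume "(i, a, j) \<in> eta \<union> nu"
    then show "a \<noteq> 0" "prec (poset_concat S P T Q) i j" using e1 n1 c by blast+
  next
    fix i a b j assume "(i, a, j) \<in> eta \<union> nu" "(i, b, j) \<in> eta \<union> nu"
    then show "a = b" using e2[of i a j b] n2[of i a j b] e1'[of i _ j] n1'[of i _ j] dis[of i] by blast
  next
    fix i a j k b
    assume ij: "(i, a, j) \<in> eta \<union> nu"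
      and k: "prec (poset_concat S P T Q) i k" "prec (poset_concat S P T Q) k j"
    show "(i, b, k) \<notin> eta \<union> nu" "(k, b, j) \<notin> eta \<union> nu"
    proof -
      consider "(i, a, j) \<in> eta" | "(i, a, j) \<in> nu" using ij by blast
      then have "((i, b, k) \<notin> eta \<union> nu) \<and> ((k, b, j) \<notin> eta \<union> nu)"
      proof cases
        case 1
        have kj: "prec P k j" using cS[OF k(2)] e1'[OF 1] by blast
        have ik: "prec P i k" using cS[OF k(1)] pS[OF kj] by blast
        show ?thesis
          using e3[OF 1 ik kj] n1'[of i b k] n1'[of k b j] pS[OF ik] pS[OF kj] dis by blast
      next
        case 2
        have ik: "prec Q i k" using cT[OF k(1)] n1'[OF 2] by blast
        have kj: "prec Q k j" using cT[OF k(2)] qT[OF ik] by blast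
        show ?thesis
          using n3[OF 2 ik kj] e1'[of i b k] e1'[of k b j] qT[OF ik] qT[OF kj] dis by blast
      qed
      then show "(i, b, k) \<notin> eta \<union> nu" "(k, b, j) \<notin> eta \<union> nu" by blast+
    qed
  qed
  moreover have False
    if ij: "(i, a, j) \<in> eta \<union> nu" and kl: "(k, b, l) \<in> eta \<union> nu"
      and ik: "prec (poset_concat S P T Q) i k" and lj: "prec (poset_concat S P T Q) l j"
    for i a j k b l
  proof -
    consider "(i, a, j) \<in> eta" | "(i, a, j) \<in> nu" using ij by blast
    then show False
    proof cases
      case 1
      have "prec P l j" using cS[OF lj] e1'[OF 1] by blast
      moreover from this have "(k, b, l) \<in> eta" using kl n1'[of k b l] pS[of l j] dis[of l] by blast
      moreover from this have "prec P i k" using cS[OF ik] e1'[of k b l] by blast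
      ultimately show False using e4[OF 1] by blast
    next
      case 2
      have "prec Q i k" using cT[OF ik] n1'[OF 2] by blast
      moreover from this have "(k, b, l) \<in> nu" using kl e1'[of k b l] qT[of i k] dis[of k] by blast
      moreover from this have "prec Q l j" using cT[OF lj] n1'[of k b l] by blast
      ultimately show False using n4[OF 2] by blast
    qed
  qed
  ultimately show ?thesis unfolding NN_def by blast
qed

end

(* Let C be the concatenated poset. If a functional is nonzero on some e_st with s in S and t in T,
   then some big arc (k, l) satisfies k <= s and t <= l, and k lies in S and l in T, so this arc is
   in neither eta nor nu. Hence a functional with big arcs eta \<union> nu vanishes on all e_st, and such
   functionals are exactly the sums of one with big arcs eta and one with big arcs nu; theta turns
   these sums into products. *)
theory Submission
  imports Defs
begin

section \<open>Elementary matrices and linear functionals\<close>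

lemma elem_mat_in_pattern_alg: "prec P i j \<Longrightarrow> elem_mat i j \<in> pattern_alg P"
  by (auto simp: pattern_alg_def elem_mat_def)

lemma pattern_dual_add:
  "lam \<in> pattern_dual P \<Longrightarrow> x \<in> pattern_alg P \<Longrightarrow> y \<in> pattern_alg P
    \<Longrightarrow> lam (mat_add x y) = lam x + lam y"
  by (simp add: pattern_dual_def)

lemma pattern_dual_smult:
  "lam \<in> pattern_dual P \<Longrightarrow> x \<in> pattern_alg P \<Longrightarrow> lam (mat_smult c x) = c * lam x"
  by (simp add: pattern_dual_def)

lemma pattern_dual_zero:
  assumes "lam \<in> pattern_dual P"
  shows "lam (\<lambda>i j. 0) = 0"
  using pattern_dual_smult[OF assms, of "\<lambda>i j. 0" 0] by (simp add: pattern_alg_def mat_smult_def)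

text \<open>A matrix supported on \<open>D\<close> is a linear combination of the elementary
  matrices at the positions in \<open>D\<close>. The induction removes one position at a time, so
  this expansion never has to be written as a sum of matrices.\<close>

lemma pattern_dual_eq_0:
  fixes lam :: "('a, 'q::field) mat \<Rightarrow> 'q"
  assumes lam: "lam \<in> pattern_dual P" and "finite D"
    and "\<And>i j. (i, j) \<in> D \<Longrightarrow> prec P i j \<and> lam (elem_mat i j) = 0"
    and "\<And>i j. (i, j) \<notin> D \<Longrightarrow> x i j = 0"
  shows "lam x = 0"
  using assms(2-)
proof (induction D arbitrary: x rule: finite_induct)
  case empty
  then have "x = (\<lambda>i j. 0)" by (simp add: fun_eq_iff)
  then show ?case using pattern_dual_zero[OF lam] by simp
next
  case (insert p D)
  obtain k l where p: "p = (k, l)" by (cases p)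
  \<comment> \<open>Split off the entry at \<open>(k, l)\<close>: \<open>y\<close> is
    \<open>x\<close> with this entry cleared, hence supported on the smaller set, and
    \<open>e\<close> carries the entry alone.\<close>
  define y where "y = (\<lambda>i j. if (i, j) = (k, l) then 0 else x i j)"
  define e :: "('a, 'q) mat" where "e = mat_smult (x k l) (elem_mat k l)"
  have kl: "prec P k l" "lam (elem_mat k l) = 0" using insert.prems(1) p by auto
  have x: "x = mat_add y e"
    by (auto simp: fun_eq_iff y_def e_def mat_add_def mat_smult_def elem_mat_def)
  have y0: "y i j = 0" if "(i, j) \<notin> D" for i j
    using insert.prems(2)[of i j] that p by (auto simp: y_def)
  have "y \<in> pattern_alg P"
    using y0 insert.prems(1) by (force simp: pattern_alg_def)
  moreover have "e \<in> pattern_alg P"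
    using kl by (auto simp: e_def pattern_alg_def mat_smult_def elem_mat_def)
  moreover have "lam y = 0" using insert.IH[of y] insert.prems(1) y0 by auto
  moreover have "lam e = 0"
    unfolding e_def using pattern_dual_smult[OF lam elem_mat_in_pattern_alg[OF kl(1)]] kl by simp
  ultimately show ?case using pattern_dual_add[OF lam, of y e] x by simp
qed

section \<open>Big arcs above a nonzero position\<close>

lemma NN_prec: "eta \<in> NN P \<Longrightarrow> (i, a, j) \<in> eta \<Longrightarrow> prec P i j"
  unfolding NN_def set_partition_def by blast

lemma mem_big_iff:
  "(i, a, j) \<in> big P lam \<longleftrightarrow> a = lam (elem_mat i j) \<and> prec P i j \<and> a \<noteq> 0 \<and>
    (\<forall>k l. (k, l) \<noteq> (i, j) \<longrightarrow> (k, i) \<in> P \<longrightarrow> (j, l) \<in> P \<longrightarrow> lam (elem_mat k l) = 0)"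
  by (auto simp: big_def)

text \<open>A maximal nonzero position above \<open>(i, j)\<close> is a big arc. The search for it
  ends because passing to a strictly larger position shrinks the finite set of positions above.
  Linearity of \<open>lam\<close> does not enter.\<close>

lemma exists_big_above:
  assumes "finite I" and P: "partial_order_on I P"
    and "prec P i j" and "lam (elem_mat i j) \<noteq> 0"
  shows "\<exists>k l a. (k, i) \<in> P \<and> (j, l) \<in> P \<and> (k, a, l) \<in> big P lam"
  using assms(3,4)
proof (induction "card {(k, l). (k, i) \<in> P \<and> (j, l) \<in> P}" arbitrary: i j rule: less_induct)
  case less
  note p = partial_order_onD[OF P]
  have ij: "(i, j) \<in> P" "i \<noteq> j" "(i, i) \<in> P" "(j, j) \<in> P"
    using less.prems(1) p(1,4) by (auto simp: prec_def refl_on_def)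
  show ?case
  proof (cases "(i, lam (elem_mat i j), j) \<in> big P lam")
    case True
    then show ?thesis using ij by blast
  next
    case False
    then obtain k l where kl: "(k, l) \<noteq> (i, j)" "(k, i) \<in> P" "(j, l) \<in> P" "lam (elem_mat k l) \<noteq> 0"
      using less.prems by (auto simp: mem_big_iff)
    have "(k, l) \<in> P" using kl ij transD[OF p(2)] by blast
    \<comment> \<open>If \<open>k = l\<close>, then \<open>j \<le> k \<le> i\<close> in the order
      \<open>P\<close>, against \<open>i\<close> lying strictly below \<open>j\<close>.\<close>
    moreover have "k \<noteq> l" using kl ij antisymD[OF p(3)] transD[OF p(2)] by blast
    ultimately have pkl: "prec P k l" by (simp add: prec_def)
    let ?U = "\<lambda>i j. {(k, l). (k, i) \<in> P \<and> (j, l) \<in> P}"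
    have "?U k l \<subseteq> ?U i j" using kl transD[OF p(2)] by blast
    \<comment> \<open>Membership of \<open>(i, j)\<close> in \<open>?U k l\<close> would make the
      two positions lie above each other, hence coincide by antisymmetry.\<close>
    moreover have "(i, j) \<in> ?U i j" "(i, j) \<notin> ?U k l"
      using kl ij antisymD[OF p(3)] by blast+
    ultimately have "?U k l \<subset> ?U i j" by blast
    moreover have "?U i j \<subseteq> I \<times> I" using p(4) by blast
    then have "finite (?U i j)"
      using \<open>finite I\<close> by (blast intro: finite_subset)
    ultimately have "card (?U k l) < card (?U i j)" by (rule psubset_card_mono[rotated])
    from less.hyps[OF this pkl kl(4)] show ?thesis
      using kl transD[OF p(2)] by blast
  qed
qed

section \<open>The concatenated order and its pattern algebra\<close>

locale disjoint_posets =
  fixes S T :: "'a set" and P Q :: "'a rel"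
  assumes fin: "finite S" "finite T" and dis: "S \<inter> T = {}"
    and P: "partial_order_on S P" and Q: "partial_order_on T Q"
begin

abbreviation C :: "'a rel" where "C \<equiv> poset_concat S P T Q"

lemma prec_P_D: "prec P x y \<Longrightarrow> x \<in> S \<and> y \<in> S \<and> x \<notin> T \<and> y \<notin> T"
  using partial_order_onD(4)[OF P] dis by (auto simp: prec_def)

lemma prec_Q_D: "prec Q x y \<Longrightarrow> x \<in> T \<and> y \<in> T \<and> x \<notin> S \<and> y \<notin> S"
  using partial_order_onD(4)[OF Q] dis by (auto simp: prec_def)

lemmas prec_C = prec_poset_concat[OF dis, of P Q]

text \<open>Each disjunct also records the non-memberships forced by disjointness, so that
  simplification sees the three cases as mutually exclusive.\<close>

lemma mem_C:
  "(x, y) \<in> C \<longleftrightarrow> (x, y) \<in> P \<and> x \<in> S \<and> y \<in> S \<and> x \<notin> T \<and> y \<notin> T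
    \<or> (x, y) \<in> Q \<and> x \<in> T \<and> y \<in> T \<and> x \<notin> S \<and> y \<notin> S \<or> x \<in> S \<and> y \<in> T \<and> x \<notin> T \<and> y \<notin> S"
  using partial_order_onD(4)[OF P] partial_order_onD(4)[OF Q] dis
  by (auto simp: poset_concat_def)

lemma pattern_alg_C: "pattern_alg P \<subseteq> pattern_alg C" "pattern_alg Q \<subseteq> pattern_alg C"
  by (auto simp: pattern_alg_def prec_C)

lemma submat_pattern_alg:
  assumes "x \<in> pattern_alg C"
  shows "submat S x \<in> pattern_alg P" "submat T x \<in> pattern_alg Q"
proof -
  have "x i j = 0" if "\<not> prec P i j" "i \<in> S" "j \<in> S" for i j
    using assms that prec_Q_D[of i j] dis by (auto simp: pattern_alg_def prec_C)
  moreover have "x i j = 0" if "\<not> prec Q i j" "i \<in> T" "j \<in> T" for i j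
    using assms that prec_P_D[of i j] dis by (auto simp: pattern_alg_def prec_C)
  ultimately show "submat S x \<in> pattern_alg P" "submat T x \<in> pattern_alg Q"
    by (auto simp: pattern_alg_def submat_def)
qed

lemma submat_pattern_alg_P:
  assumes "x \<in> pattern_alg P"
  shows "submat S x = x" "submat T x = (\<lambda>i j. 0)"
  using assms prec_P_D by (auto simp: pattern_alg_def submat_def fun_eq_iff)

lemma submat_pattern_alg_Q:
  assumes "x \<in> pattern_alg Q"
  shows "submat T x = x" "submat S x = (\<lambda>i j. 0)"
  using assms prec_Q_D by (auto simp: pattern_alg_def submat_def fun_eq_iff)

text \<open>Above a pair of \<open>P\<close> the concatenated order adds only positions that end in
  \<open>T\<close>; above a pair of \<open>Q\<close> it adds only positions that start in
  \<open>S\<close>. All these are mixed, so \<open>lam\<close> is zero there and the maximality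
  condition is the one inside the factor. Mixed pairs themselves give no arc.\<close>

lemma big_poset_concat:
  assumes lamP: "\<And>i j. prec P i j \<Longrightarrow> lam (elem_mat i j) = lam1 (elem_mat i j)"
    and lamQ: "\<And>i j. prec Q i j \<Longrightarrow> lam (elem_mat i j) = lam2 (elem_mat i j)"
    and lam0: "\<And>i j. i \<in> S \<Longrightarrow> j \<in> T \<Longrightarrow> lam (elem_mat i j) = 0"
  shows "big C lam = big P lam1 \<union> big Q lam2"
proof -
  note p = partial_order_onD[OF P] and q = partial_order_onD[OF Q]
  \<comment> \<open>Everything above a strict pair is again a strict pair, so the agreement
    hypotheses apply to it.\<close>
  have abP: "prec P k l" if "prec P i j" "(k, i) \<in> P" "(j, l) \<in> P" for i j k l
    using that transD[OF p(2)] antisymD[OF p(3)] unfolding prec_def by metis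
  have abQ: "prec Q k l" if "prec Q i j" "(k, i) \<in> Q" "(j, l) \<in> Q" for i j k l
    using that transD[OF q(2)] antisymD[OF q(3)] unfolding prec_def by metis
  have bP: "(i, a, j) \<in> big C lam \<longleftrightarrow> (i, a, j) \<in> big P lam1" if ij: "prec P i j" for i a j
  proof -
    \<comment> \<open>In the \<open>else\<close> case \<open>l\<close> lies in \<open>T\<close>
      while \<open>k\<close> lies in \<open>S\<close>, so the value is zero by
      \<open>lam0\<close>.\<close>
    have "lam (elem_mat k l) = (if (j, l) \<in> P then lam1 (elem_mat k l) else 0)"
      if "(k, i) \<in> C" "(j, l) \<in> C" for k l
      using that prec_P_D[OF ij] lam0[of k l] lamP[OF abP[OF ij], of k l] by (auto simp: mem_C)
    moreover have "(k, i) \<in> C \<longleftrightarrow> (k, i) \<in> P" for k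
      using prec_P_D[OF ij] p(4) dis by (auto simp: mem_C)
    moreover have "(j, l) \<in> P \<Longrightarrow> (j, l) \<in> C" for l by (simp add: poset_concat_def)
    ultimately show ?thesis
      using ij lamP[OF ij] unfolding mem_big_iff prec_C by metis
  qed
  have bQ: "(i, a, j) \<in> big C lam \<longleftrightarrow> (i, a, j) \<in> big Q lam2" if ij: "prec Q i j" for i a j
  proof -
    have "lam (elem_mat k l) = (if (k, i) \<in> Q then lam2 (elem_mat k l) else 0)"
      if "(k, i) \<in> C" "(j, l) \<in> C" for k l
      using that prec_Q_D[OF ij] lam0[of k l] lamQ[OF abQ[OF ij], of k l] by (auto simp: mem_C)
    moreover have "(j, l) \<in> C \<longleftrightarrow> (j, l) \<in> Q" for l
      using prec_Q_D[OF ij] q(4) dis by (auto simp: mem_C)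
    moreover have "(k, i) \<in> Q \<Longrightarrow> (k, i) \<in> C" for k by (simp add: poset_concat_def)
    ultimately show ?thesis
      using ij lamQ[OF ij] unfolding mem_big_iff prec_C by metis
  qed
  have "(i, a, j) \<in> big C lam \<longleftrightarrow> (i, a, j) \<in> big P lam1 \<union> big Q lam2" for i a j
  proof -
    consider "prec P i j" | "prec Q i j" | "\<not> prec P i j" "\<not> prec Q i j" by blast
    then show ?thesis
    proof cases
      case 1
      then have "(i, a, j) \<notin> big Q lam2" using prec_P_D[of i j] prec_Q_D[of i j] by (auto simp: mem_big_iff)
      with bP[OF 1] show ?thesis by blast
    next
      case 2
      then have "(i, a, j) \<notin> big P lam1" using prec_P_D[of i j] prec_Q_D[of i j] by (auto simp: mem_big_iff)
      with bQ[OF 2] show ?thesis by blast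
    next
      case 3
      then show ?thesis using lam0 by (auto simp: mem_big_iff prec_C)
    qed
  qed
  then show ?thesis by auto
qed

section \<open>Functionals assembled from the two factors\<close>

text \<open>The functional that glues \<open>lam1\<close> and \<open>lam2\<close> and is blind to
  the mixed block. Cutting the domain down to \<open>pattern_alg C\<close> makes it extensional, as
  \<open>pattern_dual C\<close> requires.\<close>

definition dual_sum ::
    "(('a, 'q::field) mat \<Rightarrow> 'q) \<Rightarrow> (('a, 'q) mat \<Rightarrow> 'q) \<Rightarrow> ('a, 'q) mat \<Rightarrow> 'q"
  where "dual_sum lam1 lam2 = (\<lambda>x \<in> pattern_alg C. lam1 (submat S x) + lam2 (submat T x))"

lemma dual_sum_apply:
  "x \<in> pattern_alg C \<Longrightarrow> dual_sum lam1 lam2 x = lam1 (submat S x) + lam2 (submat T x)"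
  by (simp add: dual_sum_def)

lemma dual_sum_in_pattern_dual:
  assumes "lam1 \<in> pattern_dual P" "lam2 \<in> pattern_dual Q"
  shows "dual_sum lam1 lam2 \<in> pattern_dual C"
proof -
  have cl: "mat_add x y \<in> pattern_alg C" "mat_smult c x \<in> pattern_alg C"
    if "x \<in> pattern_alg C" "y \<in> pattern_alg C" for x y :: "('a, 'b) mat" and c
    using that by (auto simp: pattern_alg_def mat_add_def mat_smult_def)
  have sub: "submat A (mat_add x y) = mat_add (submat A x) (submat A y)"
    "submat A (mat_smult c x) = mat_smult c (submat A x)" for A and x y :: "('a, 'b) mat" and c
    by (auto simp: submat_def mat_add_def mat_smult_def fun_eq_iff)
  show ?thesis
    using assms by (auto simp: pattern_dual_def[of C] dual_sum_def cl sub pattern_dual_add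
        pattern_dual_smult submat_pattern_alg algebra_simps)
qed

lemma dual_sum_P:
  assumes "lam2 \<in> pattern_dual Q" "x \<in> pattern_alg P"
  shows "dual_sum lam1 lam2 x = lam1 x"
  using assms pattern_alg_C pattern_dual_zero[OF assms(1)]
  by (auto simp: dual_sum_def submat_pattern_alg_P)

lemma dual_sum_Q:
  assumes "lam1 \<in> pattern_dual P" "x \<in> pattern_alg Q"
  shows "dual_sum lam1 lam2 x = lam2 x"
  using assms pattern_alg_C pattern_dual_zero[OF assms(1)]
  by (auto simp: dual_sum_def submat_pattern_alg_Q)

text \<open>A mixed elementary matrix has zero blocks on \<open>S\<close> and on \<open>T\<close>,
  so the glued functional kills it and \<open>big_poset_concat\<close> applies.\<close>

lemma big_dual_sum:
  assumes l1: "lam1 \<in> pattern_dual P" and l2: "lam2 \<in> pattern_dual Q"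
  shows "big C (dual_sum lam1 lam2) = big P lam1 \<union> big Q lam2"
proof (rule big_poset_concat)
  show "dual_sum lam1 lam2 (elem_mat i j) = lam1 (elem_mat i j)" if "prec P i j" for i j
    using dual_sum_P[OF l2 elem_mat_in_pattern_alg[OF that]] .
  show "dual_sum lam1 lam2 (elem_mat i j) = lam2 (elem_mat i j)" if "prec Q i j" for i j
    using dual_sum_Q[OF l1 elem_mat_in_pattern_alg[OF that]] .
  show "dual_sum lam1 lam2 (elem_mat i j) = 0" if "i \<in> S" "j \<in> T" for i j
  proof -
    have "elem_mat i j \<in> (pattern_alg C :: ('a, 'b) mat set)"
      using that by (intro elem_mat_in_pattern_alg) (simp add: prec_C)
    moreover have "submat S (elem_mat i j) = (\<lambda>i j. 0 :: 'b)" "submat T (elem_mat i j) = (\<lambda>i j. 0 :: 'b)"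
      using that dis by (auto simp: submat_def elem_mat_def fun_eq_iff)
    ultimately show ?thesis
      using pattern_dual_zero[OF l1] pattern_dual_zero[OF l2] by (simp add: dual_sum_def)
  qed
qed

section \<open>Restriction as the inverse of gluing\<close>

lemma restrict_in_pattern_dual:
  assumes "lam \<in> pattern_dual C"
  shows "restrict lam (pattern_alg P) \<in> pattern_dual P"
    "restrict lam (pattern_alg Q) \<in> pattern_dual Q"
proof -
  have cl: "mat_add x y \<in> pattern_alg R" "mat_smult c x \<in> pattern_alg R"
    if "x \<in> pattern_alg R" "y \<in> pattern_alg R" for x y :: "('a, 'b) mat" and c R
    using that by (auto simp: pattern_alg_def mat_add_def mat_smult_def)
  show "restrict lam (pattern_alg P) \<in> pattern_dual P"
    "restrict lam (pattern_alg Q) \<in> pattern_dual Q"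
    using pattern_dual_add[OF assms] pattern_dual_smult[OF assms] pattern_alg_C
    by (auto simp: pattern_dual_def cl subset_iff)
qed

text \<open>A matrix of the pattern algebra is the sum of its blocks on \<open>S\<close>, on
  \<open>T\<close> and on \<open>S \<times> T\<close>, and \<open>lam\<close> vanishes on the
  last.\<close>

lemma dual_sum_restrict:
  assumes lam: "lam \<in> pattern_dual C"
    and lam0: "\<And>i j. i \<in> S \<Longrightarrow> j \<in> T \<Longrightarrow> lam (elem_mat i j) = 0"
  shows "dual_sum (restrict lam (pattern_alg P)) (restrict lam (pattern_alg Q)) = lam"
proof (rule extensionalityI[of _ "pattern_alg C"])
  fix x :: "('a, 'b) mat" assume x: "x \<in> pattern_alg C"
  \<comment> \<open>The mixed block. There is no block on \<open>T \<times> S\<close>, since no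
    element of \<open>T\<close> precedes one of \<open>S\<close>.\<close>
  define y where "y = (\<lambda>i j. if i \<in> S \<and> j \<in> T then x i j else 0)"
  have z: "x i j = 0" if "\<not> prec C i j" for i j using x that by (simp add: pattern_alg_def)
  have "x i j = mat_add (mat_add (submat S x) (submat T x)) y i j" for i j
    using z[of i j] dis prec_P_D[of i j] prec_Q_D[of i j]
    by (cases "i \<in> S"; cases "j \<in> S"; cases "i \<in> T"; cases "j \<in> T")
      (auto simp: mat_add_def submat_def y_def prec_C)
  then have x_eq: "x = mat_add (mat_add (submat S x) (submat T x)) y" by (intro ext)
  have "lam y = 0"
    using fin lam0 by (intro pattern_dual_eq_0[OF lam, of "S \<times> T"]) (auto simp: y_def prec_C)
  moreover have "y \<in> pattern_alg C" by (auto simp: y_def pattern_alg_def prec_C)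
  moreover have s: "submat S x \<in> pattern_alg C" "submat T x \<in> pattern_alg C"
    using submat_pattern_alg[OF x] pattern_alg_C by blast+
  moreover from s have "mat_add (submat S x) (submat T x) \<in> pattern_alg C"
    by (simp add: pattern_alg_def mat_add_def)
  ultimately have "lam x = lam (submat S x) + lam (submat T x)"
    by (subst x_eq) (simp add: pattern_dual_add[OF lam])
  then show "dual_sum (restrict lam (pattern_alg P)) (restrict lam (pattern_alg Q)) x = lam x"
    using x submat_pattern_alg[OF x] by (simp add: dual_sum_def)
next
  show "lam \<in> extensional (pattern_alg C)" using lam by (simp add: pattern_dual_def)
qed (simp add: dual_sum_def)

text \<open>Off the two pattern algebras both sides are \<open>undefined\<close> by extensionality,
  which gives equality of functions and not just of their values on the subspaces.\<close>

lemma restrict_dual_sum: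
  assumes "lam1 \<in> pattern_dual P" "lam2 \<in> pattern_dual Q"
  shows "restrict (dual_sum lam1 lam2) (pattern_alg P) = lam1"
    "restrict (dual_sum lam1 lam2) (pattern_alg Q) = lam2"
proof -
  have "lam1 \<in> extensional (pattern_alg P)" "lam2 \<in> extensional (pattern_alg Q)"
    using assms by (simp_all add: pattern_dual_def)
  then show "restrict (dual_sum lam1 lam2) (pattern_alg P) = lam1"
    "restrict (dual_sum lam1 lam2) (pattern_alg Q) = lam2"
    using dual_sum_P[OF assms(2)] dual_sum_Q[OF assms(1)]
    by (auto simp: fun_eq_iff restrict_def extensional_def)
qed

text \<open>In the concatenated order \<open>S\<close> is a down-set and \<open>T\<close> an up-set,
  so whatever lies above a mixed pair is mixed.\<close>

lemma vanishes_if_big_subset: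
  assumes big: "big C lam \<subseteq> eta \<union> nu" and "eta \<in> NN P" "nu \<in> NN Q" and ij: "i \<in> S" "j \<in> T"
  shows "lam (elem_mat i j) = 0"
proof (rule ccontr)
  assume "lam (elem_mat i j) \<noteq> 0"
  moreover have "prec C i j" using ij by (simp add: prec_C)
  ultimately obtain k l a where kl: "(k, i) \<in> C" "(j, l) \<in> C" "(k, a, l) \<in> big C lam"
    using exists_big_above[OF finite_UnI[OF fin] partial_order_on_poset_concat[OF P Q dis], of i j lam]
    by blast
  have "(k, a, l) \<in> eta \<Longrightarrow> prec P k l" "(k, a, l) \<in> nu \<Longrightarrow> prec Q k l"
    using NN_prec[OF assms(2)] NN_prec[OF assms(3)] by blast+
  with kl(3) big have "prec P k l \<or> prec Q k l" by blast
  then show False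
    using kl(1,2) ij prec_P_D[of k l] prec_Q_D[of k l] by (auto simp: mem_C)
qed

text \<open>The unions agree by \<open>big_poset_concat\<close>. Arcs of the first factor start in
  \<open>S\<close> and arcs of the second in \<open>T\<close>, so a union determines both of its
  parts.\<close>

lemma big_restrict:
  assumes lam: "lam \<in> pattern_dual C" and big: "big C lam = eta \<union> nu"
    and eta: "eta \<in> NN P" and nu: "nu \<in> NN Q"
  shows "big P (restrict lam (pattern_alg P)) = eta" (is "big P ?l1 = _")
    and "big Q (restrict lam (pattern_alg Q)) = nu" (is "big Q ?l2 = _")
proof -
  have un: "big P ?l1 \<union> big Q ?l2 = eta \<union> nu"
    using big_poset_concat[of lam ?l1 ?l2] vanishes_if_big_subset[OF _ eta nu] big
    by (simp add: elem_mat_in_pattern_alg)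
  have sub: "A \<subseteq> S \<times> UNIV" if "A \<in> NN P" for A :: "('a \<times> 'b \<times> 'a) set"
  proof
    fix t assume "t \<in> A"
    moreover obtain i a j where t: "t = (i, a, j)" by (cases t)
    ultimately have "prec P i j" using NN_prec[OF that] by blast
    then show "t \<in> S \<times> UNIV" using prec_P_D t by blast
  qed
  have sub': "A \<subseteq> T \<times> UNIV" if "A \<in> NN Q" for A :: "('a \<times> 'b \<times> 'a) set"
  proof
    fix t assume "t \<in> A"
    moreover obtain i a j where t: "t = (i, a, j)" by (cases t)
    ultimately have "prec Q i j" using NN_prec[OF that] by blast
    then show "t \<in> T \<times> UNIV" using prec_Q_D t by blast
  qed
  have split: "X = X'" "Y = Y'"
    if "X \<union> Y = X' \<union> Y'" "X \<subseteq> S \<times> UNIV" "Y \<subseteq> T \<times> UNIV" "X' \<subseteq> S \<times> UNIV" "Y' \<subseteq> T \<times> UNIV"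
    for X Y X' Y' :: "('a \<times> 'b \<times> 'a) set"
  proof -
    have "X \<inter> Y' = {}" "X' \<inter> Y = {}" using that(2-5) dis by blast+
    moreover have "X \<inter> Y = {}" "X' \<inter> Y' = {}" using that(2-5) dis by blast+
    ultimately show "X = X'" "Y = Y'" using that(1) by blast+
  qed
  show "big P ?l1 = eta" "big Q ?l2 = nu"
    using split[OF un sub[OF big_in_NN[OF P]] sub'[OF big_in_NN[OF Q]] sub[OF eta] sub'[OF nu]] .
qed

text \<open>The block of an identity matrix on \<open>A\<close> is the identity matrix of
  \<open>A\<close>. This lets both factors be evaluated at blocks of one element of the
  algebra.\<close>

lemma group_to_alg_submat:
  assumes "A \<subseteq> I"
  shows "group_to_alg A (submat A g) = submat A (group_to_alg I g)"
  using assms by (auto simp: group_to_alg_def submat_def mat_one_def fun_eq_iff)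

end

section \<open>Comparison of the sums at a group element\<close>

theorem proposition8p9:
  fixes S T :: "'a set" and P Q :: "'a rel"
    and theta :: "'q::{field,finite} \<Rightarrow> complex"
    and eta nu :: "('a \<times> 'q \<times> 'a) set"
  assumes "finite S" and "finite T" and "S \<inter> T = {}"
    and "partial_order_on S P" and "partial_order_on T Q"
    and "\<And>x y. theta (x + y) = theta x * theta y"
    and "\<And>x. theta x \<noteq> 0"
    and "\<exists>x. theta x \<noteq> 1"
    and "eta \<in> NN P" and "nu \<in> NN Q"
  shows "mu S P T Q (chi theta S P eta) (chi theta T Q nu)
    = chi theta (S \<union> T) (poset_concat S P T Q) (eta \<union> nu)"
proof -
  interpret disjoint_posets S T P Q using assms(1-5) by unfold_locales
  let ?A = "{lam. lam \<in> pattern_dual P \<and> big P lam = eta}"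
  let ?B = "{lam. lam \<in> pattern_dual Q \<and> big Q lam = nu}"
  let ?D = "{lam. lam \<in> pattern_dual C \<and> big C lam = eta \<union> nu}"
  have "chi theta S P eta (submat S g) * chi theta T Q nu (submat T g)
      = chi theta (S \<union> T) C (eta \<union> nu) g" if g: "g \<in> pattern_group (S \<union> T) C" for g
  proof -
    let ?x = "group_to_alg (S \<union> T) g"
    have x: "?x \<in> pattern_alg C"
      using g by (auto simp: pattern_group_def group_to_alg_def mat_add_def)
    \<comment> \<open>Both submatrices lie in the pattern groups of the factors, so neither
      \<open>chi\<close> takes its default value \<open>undefined\<close>.\<close>
    have "chi theta S P eta (submat S g) * chi theta T Q nu (submat T g)
        = (\<Sum>lam1\<in>?A. theta (lam1 (submat S ?x))) * (\<Sum>lam2\<in>?B. theta (lam2 (submat T ?x)))"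
      using submat_pattern_group[OF P Q dis g]
      by (simp add: chi_def group_to_alg_submat[of _ "S \<union> T"])
    also have "\<dots> = (\<Sum>(lam1, lam2)\<in>?A \<times> ?B. theta (lam1 (submat S ?x) + lam2 (submat T ?x)))"
      by (simp add: sum_product sum.cartesian_product assms(6))
    also have "\<dots> = (\<Sum>lam\<in>?D. theta (lam ?x))"
    proof (rule sum.reindex_bij_witness[where j = "\<lambda>(lam1, lam2). dual_sum lam1 lam2"
          and i = "\<lambda>lam. (restrict lam (pattern_alg P), restrict lam (pattern_alg Q))"])
      fix lam assume "lam \<in> ?D"
      then have lam: "lam \<in> pattern_dual C" "big C lam = eta \<union> nu" by auto
      \<comment> \<open>The prescribed big arcs are what makes \<open>lam\<close> vanish on the
        mixed block, and so be recovered from its restrictions.\<close>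
      have "lam (elem_mat i j) = 0" if "i \<in> S" "j \<in> T" for i j
        using vanishes_if_big_subset[OF _ assms(9,10) that] lam(2) by simp
      then show "(case (restrict lam (pattern_alg P), restrict lam (pattern_alg Q)) of
          (lam1, lam2) \<Rightarrow> dual_sum lam1 lam2) = lam"
        using dual_sum_restrict[OF lam(1)] by simp
      show "(restrict lam (pattern_alg P), restrict lam (pattern_alg Q)) \<in> ?A \<times> ?B"
        using restrict_in_pattern_dual[OF lam(1)] big_restrict[OF lam assms(9,10)] by simp
    \<comment> \<open>What remains concerns a pair of functionals: restriction undoes gluing, the
      glued functional has the required big arcs, and the summands agree at
      \<open>?x\<close>.\<close>
    qed (use x in \<open>auto simp: restrict_dual_sum dual_sum_in_pattern_dual big_dual_sum dual_sum_apply\<close>)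
    also have "\<dots> = chi theta (S \<union> T) C (eta \<union> nu) g" using g by (simp add: chi_def)
    finally show ?thesis .
  qed
  then show ?thesis
    \<comment> \<open>Outside the pattern group of \<open>C\<close> both sides are
      \<open>undefined\<close>.\<close>
    unfolding mu_def by (intro ext) (auto simp: chi_def restrict_def)
qed

end
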